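(* Let $U$ be a closed subset of $\mathbb{C}$ containing $0$ and at least one more point. Let $K\subset\mathbb{C}$ be a compact set and $\epsilon>0$. Then there exists a locally univalent entire function $f\in\mathcal{E}$ satisfying $S(f)=U$ and $\|f(z)-e^{z}\|_K\leq\epsilon$.
   Context: For $\lambda\in\mathbb{C}$ put $E_\lambda(z):=\lambda e^{z}$. The class $\mathcal{E}$ consists of all entire functions $F_0:\mathbb{C}\to\mathbb{C}$ for which there exist a sequence of entire functions $(F_n)_{n\ge 1}$ and a sequence of complex numbers $(\lambda_n)_{n\geq 1}$ satisfying $F_n(z)=E_{\lambda_{n+1}}(F_{n+1}(z))=\lambda_{n+1}e^{F_{n+1}(z)}$ for all $z\in\mathbb{C}$ and all $n\geq 0$. For an entire function $f$, a critical value is a point $w=f(z)$ with $f'(z)=0$; a point $w\in\mathbb{C}$ is an asymptotic value if there is a path $\gamma:[0,\infty)\to\mathbb{C}$ with $\gamma(t)\to\infty$ and $f(\gamma(t))\to w$ as $t\to\infty$. Let $CV(f)$ and $AV(f)$ be the sets of critical values and asymptotic values. The set of singular values is $S(f):=\overline{AV(f)\cup CV(f)}$ (closure in $\mathbb{C}$). Locally univalent means locally injective, i.e. $f'$ has no zeros. $\|\cdot\|_K$ denotes the supremum norm on $K$. *)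

theory Defs
  imports "HOL-Complex_Analysis.Complex_Analysis"
begin

definition scaled_exp :: "complex \<Rightarrow> complex \<Rightarrow> complex" where
  "scaled_exp c z = c * exp z"

(* The multipliers are indexed from 1; the value c 0 is irrelevant. *)
definition iterated_exp_class :: "(complex \<Rightarrow> complex) set" where
  "iterated_exp_class =
     {F0. \<exists>(F :: nat \<Rightarrow> complex \<Rightarrow> complex) (c :: nat \<Rightarrow> complex).
            F 0 = F0 \<and> (\<forall>n. F n holomorphic_on UNIV) \<and>
            (\<forall>n z. F n z = scaled_exp (c (Suc n)) (F (Suc n) z))}"

definition critical_values :: "(complex \<Rightarrow> complex) \<Rightarrow> complex set" where
  "critical_values f = {f z |z. deriv f z = 0}"

definition asymptotic_values :: "(complex \<Rightarrow> complex) \<Rightarrow> complex set" where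
  "asymptotic_values f =
     {w. \<exists>\<gamma> :: real \<Rightarrow> complex. continuous_on {0..} \<gamma> \<and>
           filterlim \<gamma> at_infinity at_top \<and> ((\<lambda>t. f (\<gamma> t)) \<longlongrightarrow> w) at_top}"

definition singular_values :: "(complex \<Rightarrow> complex) \<Rightarrow> complex set" where
  "singular_values f = closure (asymptotic_values f \<union> critical_values f)"

definition locally_univalent :: "(complex \<Rightarrow> complex) \<Rightarrow> bool" where
  "locally_univalent f \<longleftrightarrow> (\<forall>z. \<exists>V. open V \<and> z \<in> V \<and> inj_on f V)"

lemma locally_univalent_iff_deriv_nonzero:
  assumes "f holomorphic_on UNIV"
  shows "locally_univalent f \<longleftrightarrow> (\<forall>z. deriv f z \<noteq> 0)"
proof
  assume "locally_univalent f"
  show "\<forall>z. deriv f z \<noteq> 0"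
  proof
    fix z
    obtain V where V: "open V" "z \<in> V" "inj_on f V"
      using \<open>locally_univalent f\<close> unfolding locally_univalent_def by blast
    have "f holomorphic_on V"
      using assms by (rule holomorphic_on_subset) simp
    then show "deriv f z \<noteq> 0"
      using holomorphic_injective_imp_regular V by blast
  qed
next
  assume *: "\<forall>z. deriv f z \<noteq> 0"
  show "locally_univalent f"
    unfolding locally_univalent_def
  proof
    fix z
    obtain r where "r > 0" "inj_on f (ball z r)"
      using has_complex_derivative_locally_injective[OF assms, of z] * by auto
    then show "\<exists>V. open V \<and> z \<in> V \<and> inj_on f V"
      by (intro exI[of _ "ball z r"]) auto
  qed
qed

(* Valued in ennreal so that the supremum over the empty set is 0. *)
definition sup_norm_on :: "complex set \<Rightarrow> (complex \<Rightarrow> complex) \<Rightarrow> ennreal" where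
  "sup_norm_on K g = (SUP z\<in>K. ennreal (norm (g z)))"

end

theory Submission
  imports Defs
begin

text \<open>
  Write \<open>f\<^sub>n\<close> for the tower \<open>E\<^bsub>c 1\<^esub> \<circ> \<dots> \<circ> E\<^bsub>c n\<^esub>\<close>. Its finite singular values are the numbers
  \<open>f\<^sub>j(0)\<close> with \<open>j < n\<close>. Since \<open>f\<^sub>j\<^sub>+\<^sub>1(0) = f\<^sub>j(c (j + 1))\<close>, and \<open>f\<^sub>j\<close> takes every nonzero value at some
  nonzero point, the multipliers can be chosen such that \<open>f\<^sub>j(0)\<close> runs through a dense sequence
  \<open>0 = w\<^sub>0, w\<^sub>1, w\<^sub>2, \<dots>\<close> of \<open>U\<close> (lemma \<open>exists_multipliers\<close>).

  The function \<open>f\<close> is the limit of \<open>h\<^sub>n(z) = f\<^sub>n(a\<^sub>n + \<alpha>\<^sub>n z)\<close>. Here \<open>c (n + 1) exp(a\<^sub>n\<^sub>+\<^sub>1) = a\<^sub>n\<close> and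
  \<open>\<alpha>\<^sub>n\<^sub>+\<^sub>1 = \<alpha>\<^sub>n / a\<^sub>n\<close>, so that \<open>h\<^sub>n\<^sub>+\<^sub>1(z) = f\<^sub>n(a\<^sub>n exp(\<alpha>\<^sub>n z / a\<^sub>n))\<close>. For large \<open>a\<^sub>n\<close> the argument
  of \<open>f\<^sub>n\<close> is close to \<open>a\<^sub>n + \<alpha>\<^sub>n z\<close>, and \<open>a\<^sub>n\<close> may be made large by adding a multiple of \<open>2 \<pi> \<i>\<close>,
  which is a period of \<open>f\<^sub>n\<close>. Hence \<open>h\<^sub>n\<^sub>+\<^sub>1\<close> is as close to \<open>h\<^sub>n\<close> on a given disc as desired, and the
  same holds simultaneously for the inner parts of the towers (lemma \<open>exists_rescalings\<close>). The inner
  parts from level \<open>m\<close> on converge to an entire function \<open>F\<^sub>m\<close>, and \<open>f = f\<^sub>m \<circ> F\<^sub>m\<close>; so \<open>f\<close> is an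
  infinitely iterated exponential. As \<open>h\<^sub>1 = exp\<close>, the function \<open>f\<close> is close to \<open>exp\<close> on \<open>K\<close>. All \<open>h\<^sub>n\<close>
  have derivative \<open>1\<close> at \<open>0\<close> and no critical points, and by Hurwitz's theorem neither has \<open>f\<close>.

  It remains to find the asymptotic values of \<open>f\<close>. Each \<open>w\<^sub>m\<close> is one: \<open>F\<^sub>m\<close> is entire, nonconstant
  and omits \<open>0\<close>, so by Iversen's theorem it tends to \<open>0\<close> along some path to \<open>\<infinity>\<close>
  (lemma \<open>omitted_zero_is_asymptotic_value\<close>), and along this path \<open>f = f\<^sub>m \<circ> F\<^sub>m\<close> tends to
  \<open>f\<^sub>m(0) = w\<^sub>m\<close>. Conversely, if a disc is disjoint from \<open>U\<close>, then all \<open>h\<^sub>n\<close> have inverse branches on it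
  (lemma \<open>tower_inverse_branch\<close>). By Schottky's theorem the branches starting at a given point are
  bounded uniformly in \<open>n\<close> on a smaller disc, so a path on which \<open>f\<close> tends to the centre of the disc
  stays bounded (lemma \<open>not_asymptotic_value_of_limit\<close>).
\<close>

section \<open>Towers of scaled exponentials\<close>

fun tower :: "(nat \<Rightarrow> complex) \<Rightarrow> nat \<Rightarrow> nat \<Rightarrow> complex \<Rightarrow> complex" where
  "tower c m 0 z = z"
| "tower c m (Suc k) z = tower c m k (scaled_exp (c (Suc (m + k))) z)"

lemma tower_Suc_outer:
  "tower c m (Suc k) z = scaled_exp (c (Suc m)) (tower c (Suc m) k z)"
proof (induction k arbitrary: z)
  case (Suc k)
  let ?e = "scaled_exp (c (Suc (m + Suc k)))"
  have "tower c m (Suc (Suc k)) z = tower c m (Suc k) (?e z)" by (rule tower.simps)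
  also have "\<dots> = scaled_exp (c (Suc m)) (tower c (Suc m) k (?e z))" by (rule Suc.IH)
  finally show ?case by simp
qed simp

lemma tower_has_nonzero_derivative:
  assumes "\<And>n. c (Suc n) \<noteq> 0"
  shows "\<exists>d. d \<noteq> 0 \<and> (tower c m k has_field_derivative d) (at z)"
proof (induction k arbitrary: z)
  case 0
  have "tower c m 0 = (\<lambda>z. z)" by auto
  then show ?case by (auto intro!: exI[of _ 1] derivative_eq_intros)
next
  case (Suc k)
  let ?e = "scaled_exp (c (Suc (m + k)))"
  obtain d where d: "d \<noteq> 0" "(tower c m k has_field_derivative d) (at (?e z))"
    using Suc.IH by blast
  have "(?e has_field_derivative ?e z) (at z)"
    unfolding scaled_exp_def by (auto intro!: derivative_eq_intros)
  from DERIV_chain[OF d(2) this]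
  moreover have "tower c m k \<circ> ?e = tower c m (Suc k)"
    by auto
  ultimately have "(tower c m (Suc k) has_field_derivative d * ?e z) (at z)"
    by metis
  moreover have "d * ?e z \<noteq> 0"
    using d assms by (auto simp: scaled_exp_def)
  ultimately show ?case by blast
qed

lemma tower_holomorphic: "tower c m k holomorphic_on S"
proof (induction k arbitrary: S)
  case 0
  have "tower c m 0 = (\<lambda>z. z)" by auto
  then show ?case by simp
next
  case (Suc k)
  have "tower c m (Suc k) = tower c m k \<circ> scaled_exp (c (Suc (m + k)))"
    by auto
  moreover have "scaled_exp (c (Suc (m + k))) holomorphic_on S"
    unfolding scaled_exp_def by (intro holomorphic_intros)
  ultimately show ?case
    using holomorphic_on_compose Suc.IH by metis
qed

lemma exp_add_period: "exp (z + 2 * of_real pi * \<i> * of_nat j) = (exp z :: complex)"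
proof -
  have "2 * of_real pi * \<i> * of_nat j = of_int (2 * int j) * (of_real pi * \<i>)"
    by simp
  then show ?thesis
    using exp_plus_2pin[of z "int j"] by (simp add: mult_ac)
qed

text \<open>A nonempty tower has period \<open>2 \<pi> \<i>\<close>, and the empty tower is the identity; differences of
  values are translation invariant in both cases, so one statement serves both.\<close>

lemma tower_diff_period:
  "tower c m k (x + 2 * of_real pi * \<i> * of_nat j) - tower c m k (y + 2 * of_real pi * \<i> * of_nat j)
   = tower c m k x - tower c m k y"
proof (cases k)
  case (Suc k')
  then show ?thesis by (simp only: tower.simps scaled_exp_def exp_add_period)
qed simp

lemma tower_nonzero_preimage:
  assumes "\<And>n. c (Suc n) \<noteq> 0" "w \<noteq> 0"
  shows "\<exists>x. x \<noteq> 0 \<and> tower c m k x = w"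
proof (induction k)
  case 0
  then show ?case using assms by auto
next
  case (Suc k)
  then obtain x where x: "x \<noteq> 0" "tower c m k x = w" by blast
  define b where "b = Ln (x / c (Suc (m + k)))"
  have b: "exp b = x / c (Suc (m + k))"
    unfolding b_def using x assms by simp
  show ?case
  proof (cases "b = 0")
    case False
    then show ?thesis using b x assms by (intro exI[of _ b]) (auto simp: scaled_exp_def)
  next
    case True
    then show ?thesis using b x assms exp_add_period[of b 1]
      by (intro exI[of _ "2 * of_real pi * \<i>"]) (auto simp: scaled_exp_def)
  qed
qed

text \<open>The finite singular values of a tower are the images of \<open>0\<close> under its initial parts: \<open>0\<close> is the
  only point over which an exponential fails to be a covering. On a convex set free of them,
  branches of the logarithm can be taken one after the other, with the additive constant of each
  logarithm dictated by the point through which the branch has to pass.\<close>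

lemma tower_inverse_branch:
  assumes c: "\<And>n. c (Suc n) \<noteq> 0"
    and B: "convex B" 
    and sing: "\<And>j. j < k \<Longrightarrow> tower c m j 0 \<notin> B"
    and y: "tower c m k y \<in> B"
  shows "\<exists>\<psi>. \<psi> holomorphic_on B \<and> (\<forall>u\<in>B. tower c m k (\<psi> u) = u) \<and> \<psi> (tower c m k y) = y"
  using sing y
proof (induction k arbitrary: y)
  case 0
  then show ?case by (intro exI[of _ "\<lambda>u. u"]) auto
next
  case (Suc k)
  let ?l = "c (Suc (m + k))"
  let ?v = "tower c m (Suc k) y"
  obtain \<psi> where \<psi>: "\<psi> holomorphic_on B" "\<And>u. u \<in> B \<Longrightarrow> tower c m k (\<psi> u) = u"
      "\<psi> ?v = scaled_exp ?l y"
    using Suc.IH[of "scaled_exp ?l y"] Suc.prems by auto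
  have nz: "\<psi> u / ?l \<noteq> 0" if "u \<in> B" for u
    using \<psi>(2)[OF that] Suc.prems(1)[of k] that c by auto
  have "(\<lambda>u. \<psi> u / ?l) holomorphic_on B"
    using c \<psi>(1) by (intro holomorphic_intros) auto
  then obtain g where g: "g holomorphic_on B" "\<And>u. u \<in> B \<Longrightarrow> \<psi> u / ?l = exp (g u)"
    using contractible_imp_holomorphic_log[of "\<lambda>u. \<psi> u / ?l" B] convex_imp_contractible[OF B] nz
    by blast
  define G where "G u = g u + (y - g ?v)" for u
  have "exp (g ?v) = exp y"
    using g(2)[of ?v] Suc.prems(2) \<psi>(3) c by (simp add: scaled_exp_def)
  then have "exp (y - g ?v) = 1"
    by (simp add: exp_diff)
  then have G: "scaled_exp ?l (G u) = \<psi> u" if "u \<in> B" for u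
    using g(2)[OF that, symmetric] c by (simp add: G_def exp_add scaled_exp_def)
  show ?case
  proof (intro exI conjI ballI)
    show "G holomorphic_on B"
      unfolding G_def using g by (intro holomorphic_intros)
    show "tower c m (Suc k) (G u) = u" if "u \<in> B" for u
      using G that \<psi> by simp
    show "G ?v = y" by (simp add: G_def)
  qed
qed

text \<open>The multipliers can be chosen to prescribe the singular values of all towers: the value
  \<open>tower c 0 (Suc n) 0\<close> equals \<open>tower c 0 n (c (Suc n))\<close>, and every nonzero number has a nonzero
  preimage under \<open>tower c 0 n\<close>.\<close>

lemma exists_multipliers:
  fixes w :: "nat \<Rightarrow> complex"
  assumes w: "\<And>n. w (Suc n) \<noteq> 0"
  obtains c where "\<And>n. c (Suc n) \<noteq> 0" "\<And>n. tower c 0 (Suc n) 0 = w (Suc n)"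
proof -
  \<comment> \<open>The state carries the tower built so far next to its last multiplier, so that the choice of
    the next multiplier depends on the current state only.\<close>
  define P :: "nat \<Rightarrow> complex \<times> (complex \<Rightarrow> complex) \<Rightarrow> bool" where
    "P n s \<longleftrightarrow> fst s \<noteq> 0 \<and> (\<forall>v. v \<noteq> 0 \<longrightarrow> (\<exists>x. x \<noteq> 0 \<and> snd s x = v))" for n s
  define Q :: "nat \<Rightarrow> complex \<times> (complex \<Rightarrow> complex) \<Rightarrow> complex \<times> (complex \<Rightarrow> complex) \<Rightarrow> bool" where
    "Q n s t \<longleftrightarrow> snd s (fst t) = w (Suc n) \<and> snd t = (\<lambda>z. snd s (scaled_exp (fst t) z))" for n s t
  have step: "\<exists>t. P (Suc n) t \<and> Q n s t" if "P n s" for n s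
  proof -
    have pre: "\<exists>x. x \<noteq> 0 \<and> snd s x = v" if "v \<noteq> 0" for v
      using \<open>P n s\<close> that by (simp add: P_def)
    obtain l where l: "l \<noteq> 0" "snd s l = w (Suc n)"
      using pre[of "w (Suc n)"] w by auto
    have "\<exists>x. x \<noteq> 0 \<and> snd s (scaled_exp l x) = v" if v: "v \<noteq> 0" for v
    proof -
      obtain x where x: "x \<noteq> 0" "snd s x = v"
        using pre[OF v] by auto
      obtain y where "y \<noteq> 0" "tower (\<lambda>_. l) 0 1 y = x"
        using tower_nonzero_preimage[of "\<lambda>_. l" x 0 1] x l by auto
      then show ?thesis using x by (intro exI[of _ y]) auto
    qed
    then show ?thesis using l
      by (intro exI[of _ "(l, \<lambda>z. snd s (scaled_exp l z))"]) (auto simp: P_def Q_def)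
  qed
  have "\<exists>s. \<forall>n. (P n (s n) \<and> (n = 0 \<longrightarrow> s n = (1, \<lambda>z. z))) \<and> Q n (s n) (s (Suc n))"
  proof (rule dependent_nat_choice)
    show "\<exists>x. P 0 x \<and> (0 = (0::nat) \<longrightarrow> x = (1, \<lambda>z. z))"
      by (auto simp: P_def)
    show "\<exists>y. (P (Suc n) y \<and> (Suc n = 0 \<longrightarrow> y = (1, \<lambda>z. z))) \<and> Q n x y"
      if "P n x \<and> (n = 0 \<longrightarrow> x = (1, \<lambda>z. z))" for n x
      using step[of n x] that by simp
  qed
  then obtain s where s: "s 0 = (1, \<lambda>z. z)" "\<And>n. P n (s n)" "\<And>n. Q n (s n) (s (Suc n))"
    by blast
  define c where "c n = fst (s n)" for n
  have tow: "snd (s n) = tower c 0 n" for n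
  proof (induction n)
    case (Suc n)
    have "snd (s (Suc n)) z = tower c 0 (Suc n) z" for z
      using s(3)[of n] Suc by (simp add: Q_def c_def[symmetric])
    then show ?case by blast
  qed (use s in auto)
  show ?thesis
  proof
    show "c (Suc n) \<noteq> 0" for n
      using s(2)[of "Suc n"] by (simp add: P_def c_def)
    show "tower c 0 (Suc n) 0 = w (Suc n)" for n
      using s(3)[of n] tow[of n] by (simp add: Q_def c_def scaled_exp_def)
  qed
qed

section \<open>The approximating sequence\<close>

lemma norm_exp_minus_linear_le:
  fixes u :: complex
  assumes "norm u \<le> 1"
  shows "norm (exp u - 1 - u) \<le> 3 * (norm u)\<^sup>2"
proof -
  have "norm (exp u - (\<Sum>i\<le>1. u ^ i / fact i)) \<le> exp (norm u) * norm u ^ Suc 1 / fact 1"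
    by (rule Taylor_exp_field)
  then have "norm (exp u - 1 - u) \<le> exp (norm u) * (norm u)\<^sup>2"
    by (simp add: algebra_simps power2_eq_square)
  also have "\<dots> \<le> 3 * (norm u)\<^sup>2"
    using assms exp_le order_trans[of "exp (norm u)" "exp 1" 3] by (intro mult_right_mono) auto
  finally show ?thesis .
qed

text \<open>An exponential looks affine far away from its singular value: this is what allows a further
  exponential to be inserted at negligible cost.\<close>

lemma eventually_exp_near_affine:
  fixes \<alpha> :: complex
  assumes "\<delta> > 0"
  shows "\<forall>\<^sub>F a in at_infinity. \<forall>z\<in>cball 0 R. norm (a * exp (\<alpha> * z / a) - (a + \<alpha> * z)) < \<delta>"
proof -
  define C where "C = norm \<alpha> * \<bar>R\<bar>"
  have C: "C \<ge> 0" by (simp add: C_def)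
  have "norm (a * exp (\<alpha> * z / a) - (a + \<alpha> * z)) < \<delta>"
    if a: "norm a \<ge> 1 + C + 3 * C\<^sup>2 / \<delta>" and z: "z \<in> cball 0 R" for a z
  proof -
    let ?u = "\<alpha> * z / a"
    have pos: "3 * C\<^sup>2 / \<delta> \<ge> 0" using assms by simp
    have a0: "norm a > 0" "norm a \<ge> C" "norm a > 3 * C\<^sup>2 / \<delta>"
      using a C pos by linarith+
    have az: "norm (\<alpha> * z) \<le> C"
      using z unfolding C_def norm_mult by (intro mult_left_mono) auto
    have u: "norm ?u \<le> 1"
      using az a0 by (simp add: norm_divide divide_le_eq)
    have "a * exp ?u - (a + \<alpha> * z) = a * (exp ?u - 1 - ?u)"
      using a0 by (auto simp: field_simps)
    then have "norm (a * exp ?u - (a + \<alpha> * z)) \<le> norm a * (3 * (norm ?u)\<^sup>2)"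
      using norm_exp_minus_linear_le[OF u] by (simp only: norm_mult mult_left_mono norm_ge_zero)
    also have "\<dots> = 3 * (norm (\<alpha> * z))\<^sup>2 / norm a"
      using a0 by (simp add: norm_divide power2_eq_square field_simps)
    also have "\<dots> \<le> 3 * C\<^sup>2 / norm a"
      using az a0 by (intro divide_right_mono mult_left_mono power_mono) auto
    also have "\<dots> < \<delta>"
      using a0 assms by (simp add: field_simps)
    finally show ?thesis .
  qed
  then show ?thesis
    unfolding eventually_at_infinity by blast
qed

lemma filterlim_period_translates:
  "filterlim (\<lambda>j. a + 2 * of_real pi * \<i> * of_nat j :: complex) at_infinity sequentially"
  by (intro tendsto_add_filterlim_at_infinity[OF tendsto_const]
      tendsto_mult_filterlim_at_infinity[OF tendsto_const] tendsto_of_nat) auto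

text \<open>The error of the inserted exponential survives composition with an entire function \<open>G\<close>, even
  though the base point \<open>b j\<close> runs off to infinity: by periodicity \<open>G\<close> may be evaluated near \<open>a\<close>,
  where it is uniformly continuous.\<close>

lemma eventually_insert_exp:
  fixes a \<alpha> :: complex
  assumes G: "G holomorphic_on UNIV"
    and shift: "\<And>j x y. G (x + 2 * of_real pi * \<i> * of_nat j) - G (y + 2 * of_real pi * \<i> * of_nat j)
                  = G x - G y"
    and e: "e > 0"
  defines "b \<equiv> \<lambda>j. a + 2 * of_real pi * \<i> * of_nat j"
  shows "\<forall>\<^sub>F j in sequentially. \<forall>z\<in>cball 0 R.
           norm (G (b j * exp (\<alpha> * z / b j)) - G (b j + \<alpha> * z)) \<le> e"
proof -
  define S where "S = cball a (norm \<alpha> * \<bar>R\<bar> + 1)"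
  have "uniformly_continuous_on S G"
    unfolding S_def using G holomorphic_on_imp_continuous_on holomorphic_on_subset
    by (intro compact_uniformly_continuous) (blast, simp)
  then obtain \<delta> where \<delta>: "\<delta> > 0"
    "\<And>x y. x \<in> S \<Longrightarrow> y \<in> S \<Longrightarrow> dist y x < \<delta> \<Longrightarrow> dist (G y) (G x) < e"
    using e unfolding uniformly_continuous_on_def by metis
  have "filterlim b at_infinity sequentially"
    unfolding b_def by (rule filterlim_period_translates)
  then have "\<forall>\<^sub>F j in sequentially. \<forall>z\<in>cball 0 R.
               norm (b j * exp (\<alpha> * z / b j) - (b j + \<alpha> * z)) < min \<delta> 1"
    using eventually_exp_near_affine[of "min \<delta> 1" R \<alpha>] \<delta> by (auto simp: filterlim_iff)
  then show ?thesis
  proof eventually_elim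
    case (elim j)
    show ?case
    proof
      fix z :: complex
      assume z: "z \<in> cball 0 R"
      \<comment> \<open>Translating back by the period moves both arguments into the fixed compact set \<open>S\<close>.\<close>
      define x where "x = a + \<alpha> * z"
      define y where "y = b j * exp (\<alpha> * z / b j) - 2 * of_real pi * \<i> * of_nat j"
      have "norm (\<alpha> * z) \<le> norm \<alpha> * \<bar>R\<bar>"
        using z unfolding norm_mult by (intro mult_left_mono) auto
      moreover have yx: "norm (y - x) < min \<delta> 1"
        using elim z by (auto simp: x_def y_def b_def algebra_simps)
      moreover have "norm (y - a) \<le> norm (y - x) + norm (\<alpha> * z)"
        using norm_triangle_ineq[of "y - x" "\<alpha> * z"] by (simp add: x_def)
      ultimately have "x \<in> S" "y \<in> S" "dist y x < \<delta>"
        by (auto simp: S_def x_def dist_norm norm_minus_commute)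
      then have "norm (G y - G x) < e"
        using \<delta> by (auto simp: dist_norm)
      moreover have "G (b j * exp (\<alpha> * z / b j)) - G (b j + \<alpha> * z) = G y - G x"
        using shift[of y j x] by (simp add: x_def y_def b_def algebra_simps)
      ultimately show "norm (G (b j * exp (\<alpha> * z / b j)) - G (b j + \<alpha> * z)) \<le> e"
        by simp
    qed
  qed
qed

text \<open>The parameters of the approximations \<open>tower c 0 n (a n + \<alpha> n * z)\<close>. Passing from \<open>n\<close> to
  \<open>Suc n\<close> replaces the affine map \<open>a n + \<alpha> n * z\<close> by \<open>a n * exp (\<alpha> n * z / a n)\<close>, which equals
  \<open>c (Suc n) * exp (a (Suc n) + \<alpha> (Suc n) * z)\<close>. Since \<open>a n\<close> is prescribed only up to multiples of the
  period, it can be taken so large that this replacement changes neither the approximation nor any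
  of its inner parts, which start at level \<open>m\<close> of the tower, by more than \<open>\<epsilon> / 2 ^ n\<close>. The step from \<open>0\<close> to \<open>1\<close>, which replaces
  \<open>1 + z\<close> by \<open>exp z\<close>, is not small; the estimates begin with \<open>n = 1\<close>.\<close>

lemma exists_rescalings:
  fixes c :: "nat \<Rightarrow> complex"
  assumes c: "\<And>n. c (Suc n) \<noteq> 0" and e: "\<epsilon> > 0"
  obtains a \<alpha> :: "nat \<Rightarrow> complex" where "a 0 = 1" "\<alpha> 0 = 1" "\<And>n. a n \<noteq> 0" "\<And>n. \<alpha> n \<noteq> 0"
    "\<And>n. c (Suc n) * exp (a (Suc n)) = a n" "\<And>n. \<alpha> (Suc n) = \<alpha> n / a n"
    "\<And>n m z. 1 \<le> n \<Longrightarrow> m \<le> n \<Longrightarrow> norm z \<le> R + real n \<Longrightarrow>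
       norm (tower c m (n - m) (a n * exp (\<alpha> n * z / a n)) - tower c m (n - m) (a n + \<alpha> n * z))
         \<le> \<epsilon> / 2 ^ n"
proof -
  define good :: "nat \<Rightarrow> complex \<Rightarrow> complex \<Rightarrow> bool" where
    "good n a \<alpha> \<longleftrightarrow> (\<forall>m\<in>{..n}. \<forall>z\<in>cball 0 (R + real n).
       norm (tower c m (n - m) (a * exp (\<alpha> * z / a)) - tower c m (n - m) (a + \<alpha> * z)) \<le> \<epsilon> / 2 ^ n)"
    for n a \<alpha>
  define P :: "nat \<Rightarrow> complex \<times> complex \<Rightarrow> bool" where
    "P n s \<longleftrightarrow> fst s \<noteq> 0 \<and> snd s \<noteq> 0 \<and> (n = 0 \<longrightarrow> s = (1, 1)) \<and> (1 \<le> n \<longrightarrow> good n (fst s) (snd s))" for n s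
  define Q :: "nat \<Rightarrow> complex \<times> complex \<Rightarrow> complex \<times> complex \<Rightarrow> bool" where
    "Q n s t \<longleftrightarrow> c (Suc n) * exp (fst t) = fst s \<and> snd t = snd s / fst s" for n s t
  have "\<exists>s. \<forall>n. P n (s n) \<and> Q n (s n) (s (Suc n))"
  proof (rule dependent_nat_choice)
    show "\<exists>s. P 0 s" by (simp add: P_def)
  next
    fix s n assume "P n s"
    then have s: "fst s \<noteq> 0" "snd s \<noteq> 0" by (auto simp: P_def)
    define a0 where "a0 = Ln (fst s / c (Suc n))"
    define b where "b j = a0 + 2 * of_real pi * \<i> * of_nat j" for j
    define \<beta> where "\<beta> = snd s / fst s"
    have "\<forall>\<^sub>F j in sequentially. \<forall>m\<in>{..Suc n}. \<forall>z\<in>cball 0 (R + real (Suc n)).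
       norm (tower c m (Suc n - m) (b j * exp (\<beta> * z / b j)) - tower c m (Suc n - m) (b j + \<beta> * z))
         \<le> \<epsilon> / 2 ^ Suc n"
      unfolding b_def using e
      by (intro eventually_ball_finite ballI eventually_insert_exp tower_holomorphic tower_diff_period)
        auto
    moreover have "\<forall>\<^sub>F j in sequentially. b j \<noteq> 0"
      unfolding b_def
      by (intro filterlim_at_infinity_imp_eventually_ne filterlim_period_translates)
    ultimately have "\<forall>\<^sub>F j in sequentially. good (Suc n) (b j) \<beta> \<and> b j \<noteq> 0"
      unfolding good_def by (rule eventually_conj)
    then obtain j where j: "good (Suc n) (b j) \<beta>" "b j \<noteq> 0"
      by (auto simp: eventually_sequentially)
    have "c (Suc n) * exp (b j) = fst s"
      using s c by (simp add: b_def exp_add_period a0_def)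
    then show "\<exists>t. P (Suc n) t \<and> Q n s t"
      using j s by (intro exI[of _ "(b j, \<beta>)"]) (simp add: P_def Q_def \<beta>_def)
  qed
  then obtain s where s: "\<And>n. P n (s n)" "\<And>n. Q n (s n) (s (Suc n))" by blast
  show ?thesis
  proof (rule that[of "\<lambda>n. fst (s n)" "\<lambda>n. snd (s n)"])
    fix n m and z :: complex
    assume "1 \<le> n" "m \<le> n" "norm z \<le> R + real n"
    then show "norm (tower c m (n - m) (fst (s n) * exp (snd (s n) * z / fst (s n)))
        - tower c m (n - m) (fst (s n) + snd (s n) * z)) \<le> \<epsilon> / 2 ^ n"
      using s(1)[of n] by (simp add: P_def good_def)
  qed (use s(1)[of 0] s(1) s(2) in \<open>auto simp: P_def Q_def\<close>)
qed

section \<open>Locally uniform limits of entire functions\<close>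

lemma geometric_uniform_limit:
  fixes g :: "nat \<Rightarrow> complex \<Rightarrow> complex"
  assumes hol: "\<And>n. g n holomorphic_on UNIV"
    and close: "\<And>n z. N \<le> n \<Longrightarrow> norm z \<le> R + real n \<Longrightarrow> norm (g (Suc n) z - g n z) \<le> \<epsilon> / 2 ^ n"
    and e: "\<epsilon> > 0"
  obtains G where "G holomorphic_on UNIV" "\<And>r. uniform_limit (cball 0 r) g G sequentially"
    "\<And>n z. N \<le> n \<Longrightarrow> norm z \<le> R + real n \<Longrightarrow> norm (G z - g n z) \<le> 2 * \<epsilon> / 2 ^ n"
proof -
  have tele: "norm (g (n + k) z - g n z) \<le> 2 * \<epsilon> / 2 ^ n - 2 * \<epsilon> / 2 ^ (n + k)"
    if "N \<le> n" "norm z \<le> R + real n" for n k z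
  proof (induction k)
    case (Suc k)
    have "norm (g (Suc (n + k)) z - g (n + k) z) \<le> \<epsilon> / 2 ^ (n + k)"
      using that by (intro close) auto
    moreover have "norm (g (n + Suc k) z - g n z)
        \<le> norm (g (Suc (n + k)) z - g (n + k) z) + norm (g (n + k) z - g n z)"
      using norm_triangle_ineq[of "g (Suc (n + k)) z - g (n + k) z" "g (n + k) z - g n z"] by simp
    ultimately have "norm (g (n + Suc k) z - g n z)
        \<le> \<epsilon> / 2 ^ (n + k) + (2 * \<epsilon> / 2 ^ n - 2 * \<epsilon> / 2 ^ (n + k))"
      using Suc by linarith
    also have "\<dots> = 2 * \<epsilon> / 2 ^ n - 2 * \<epsilon> / 2 ^ (n + Suc k)"
      by (simp add: field_simps)
    finally show ?case .
  qed simp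
  have bound: "norm (g k z - g n z) \<le> 2 * \<epsilon> / 2 ^ n"
    if "N \<le> n" "norm z \<le> R + real n" "n \<le> k" for n k z
  proof -
    have "norm (g (n + (k - n)) z - g n z) \<le> 2 * \<epsilon> / 2 ^ n - 2 * \<epsilon> / 2 ^ (n + (k - n))"
      using that by (intro tele) auto
    moreover have "2 * \<epsilon> / 2 ^ (n + (k - n)) \<ge> 0" using e by simp
    ultimately show ?thesis using that by simp
  qed
  have small: "\<exists>n. N \<le> n \<and> r \<le> R + real n \<and> 2 * \<epsilon> / 2 ^ n < d" if "d > 0" for d r
  proof -
    have "(\<lambda>n. 2 * \<epsilon> / 2 ^ n) \<longlonglongrightarrow> 0" by real_asymp
    then have "\<forall>\<^sub>F n in sequentially. 2 * \<epsilon> / 2 ^ n < d"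
      using that by (rule order_tendstoD)
    moreover have "\<forall>\<^sub>F n in sequentially. r \<le> R + real n" by real_asymp
    moreover have "\<forall>\<^sub>F n in sequentially. N \<le> n" by (rule eventually_ge_at_top)
    ultimately have "\<forall>\<^sub>F n in sequentially. N \<le> n \<and> r \<le> R + real n \<and> 2 * \<epsilon> / 2 ^ n < d"
      by eventually_elim simp
    then show ?thesis by (auto simp: eventually_sequentially)
  qed
  have conv: "convergent (\<lambda>n. g n z)" for z
  proof (rule Cauchy_convergent, rule metric_CauchyI)
    fix d :: real assume "d > 0"
    then obtain n where n: "N \<le> n" "norm z \<le> R + real n" "2 * \<epsilon> / 2 ^ n < d / 2"
      using small[of "d / 2" "norm z"] by auto
    have "dist (g i z) (g j z) < d" if "i \<ge> n" "j \<ge> n" for i j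
      using bound[OF n(1,2) that(1)] bound[OF n(1,2) that(2)] n(3)
        norm_triangle_ineq4[of "g i z - g n z" "g j z - g n z"] by (simp add: dist_norm)
    then show "\<exists>M. \<forall>m\<ge>M. \<forall>n\<ge>M. dist (g m z) (g n z) < d" by blast
  qed
  define G where "G z = lim (\<lambda>n. g n z)" for z
  have lim: "(\<lambda>n. g n z) \<longlonglongrightarrow> G z" for z
    using conv unfolding G_def by (simp add: convergent_LIMSEQ_iff)
  have Gb: "norm (G z - g n z) \<le> 2 * \<epsilon> / 2 ^ n" if "N \<le> n" "norm z \<le> R + real n" for n z
  proof (rule tendsto_upperbound)
    show "((\<lambda>k. norm (g k z - g n z)) \<longlongrightarrow> norm (G z - g n z)) sequentially"
      by (intro tendsto_intros lim)
    show "\<forall>\<^sub>F k in sequentially. norm (g k z - g n z) \<le> 2 * \<epsilon> / 2 ^ n"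
      using bound[OF that] by (auto simp: eventually_sequentially)
  qed auto
  have ul: "uniform_limit (cball 0 r) g G sequentially" for r
  proof (rule uniform_limitI)
    fix d :: real assume "d > 0"
    then obtain n where n: "N \<le> n" "r \<le> R + real n" "2 * \<epsilon> / 2 ^ n < d"
      using small by blast
    have "dist (g k z) (G z) < d" if "k \<ge> n" "z \<in> cball 0 r" for k z
    proof -
      have "norm (G z - g k z) \<le> 2 * \<epsilon> / 2 ^ k" using that n by (intro Gb) auto
      also have "\<dots> \<le> 2 * \<epsilon> / 2 ^ n" using that e by (intro divide_left_mono power_increasing) auto
      finally show ?thesis using n by (simp add: dist_norm norm_minus_commute)
    qed
    then show "\<forall>\<^sub>F k in sequentially. \<forall>z\<in>cball 0 r. dist (g k z) (G z) < d"
      unfolding eventually_sequentially by blast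
  qed
  have "G holomorphic_on UNIV"
  proof (rule holomorphic_uniform_sequence[OF _ hol])
    show "\<exists>d>0. cball x d \<subseteq> UNIV \<and> uniform_limit (cball x d) g G sequentially" for x
    proof (intro exI[of _ 1] conjI uniform_limit_on_subset[OF ul[of "norm x + 1"]])
      show "cball x 1 \<subseteq> cball 0 (norm x + 1)"
      proof
        fix y assume "y \<in> cball x 1"
        then show "y \<in> cball 0 (norm x + 1)"
          using norm_triangle_sub[of y x] by (simp add: dist_norm norm_minus_commute)
      qed
    qed auto
  qed auto
  then show ?thesis using that ul Gb by blast
qed

lemma uniform_limit_deriv:
  fixes g :: "nat \<Rightarrow> complex \<Rightarrow> complex"
  assumes hol: "\<And>n. g n holomorphic_on UNIV" "G holomorphic_on UNIV"
    and ul: "\<And>r. uniform_limit (cball 0 r) g G sequentially"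
  shows "uniform_limit (cball 0 r) (\<lambda>n. deriv (g n)) (deriv G) sequentially"
proof (rule uniform_limitI)
  fix d :: real assume d: "d > 0"
  have "\<forall>\<^sub>F n in sequentially. \<forall>z\<in>cball 0 (r + 1). dist (g n z) (G z) < d / 2"
    using uniform_limitD[OF ul, of "d / 2"] d by simp
  then show "\<forall>\<^sub>F n in sequentially. \<forall>z\<in>cball 0 r. dist (deriv (g n) z) (deriv G z) < d"
  proof eventually_elim
    case (elim n)
    show ?case
    proof
      fix z :: complex assume z: "z \<in> cball 0 r"
      have h: "(\<lambda>x. g n x - G x) holomorphic_on S" for S
        using hol by (intro holomorphic_on_diff) (blast intro: holomorphic_on_subset)+
      have "norm ((deriv ^^ 1) (\<lambda>x. g n x - G x) z) \<le> fact 1 * (d / 2) / 1 ^ 1"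
      proof (rule Cauchy_inequality)
        show "norm (g n x - G x) \<le> d / 2" if "norm (z - x) = 1" for x
        proof -
          have "norm x \<le> r + 1"
            using z that norm_triangle_ineq4[of z "z - x"] by auto
          then show ?thesis using elim by (force simp: dist_norm)
        qed
      qed (use h holomorphic_on_imp_continuous_on in auto)
      moreover have "deriv (\<lambda>x. g n x - G x) z = deriv (g n) z - deriv G z"
        using hol by (intro deriv_diff) (auto intro: holomorphic_on_imp_differentiable_at)
      ultimately show "dist (deriv (g n) z) (deriv G z) < d"
        using d by (simp add: dist_norm)
    qed
  qed
qed

text \<open>Hurwitz for the derivatives. His theorem needs the limiting derivative to be nonconstant; a
  constant derivative agrees with its nonzero value at \<open>z0\<close>.\<close>

lemma deriv_limit_nonzero:
  fixes g :: "nat \<Rightarrow> complex \<Rightarrow> complex"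
  assumes hol: "\<And>n. g n holomorphic_on UNIV" "G holomorphic_on UNIV"
    and ul: "\<And>r. uniform_limit (cball 0 r) g G sequentially"
    and nz: "\<And>n z. deriv (g n) z \<noteq> 0"
    and z0: "deriv G z0 \<noteq> 0"
  shows "deriv G z \<noteq> 0"
proof (cases "deriv G constant_on UNIV")
  case True
  then show ?thesis using z0 by (metis UNIV_I constant_on_def)
next
  case False
  show ?thesis
  proof (rule Hurwitz_no_zeros[of UNIV "\<lambda>n. deriv (g n)" "deriv G"])
    show "uniform_limit K (\<lambda>n. deriv (g n)) (deriv G) sequentially" if "compact K" for K :: "complex set"
    proof -
      obtain r where "K \<subseteq> cball 0 r"
        using compact_imp_bounded[OF \<open>compact K\<close>] by (auto simp: bounded_iff subset_iff)
      then show ?thesis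
        using uniform_limit_deriv[OF hol ul] uniform_limit_on_subset by blast
    qed
  qed (use hol nz False in \<open>auto intro: holomorphic_deriv\<close>)
qed

section \<open>Asymptotic values\<close>

lemma entire_exceeds_norm:
  fixes g :: "complex \<Rightarrow> complex"
  assumes "g holomorphic_on UNIV" "\<not> g constant_on UNIV"
  shows "\<exists>z. norm (g z) > M"
proof (rule ccontr)
  assume "\<not> ?thesis"
  then have "bounded (range g)" by (auto simp: bounded_iff not_less)
  then show False using Liouville_theorem assms by blast
qed

text \<open>This is a maximum principle of Phragmen-Lindelof type for the component \<open>D\<close> of \<open>z0\<close>, on whose
  boundary \<open>norm g \<le> s\<close>. If \<open>g\<close> were bounded on \<open>D\<close>, the quotients \<open>(g / s)\<^sup>N / (z - p)\<close>, with \<open>p\<close>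
  outside the closure of \<open>D\<close>, would decay at infinity, and the ordinary maximum principle would
  bound them by a constant independent of \<open>N\<close>. Taking \<open>N\<close>-th roots then gives \<open>norm (g z0) \<le> s\<close>.\<close>

lemma unbounded_on_superlevel_component:
  fixes g :: "complex \<Rightarrow> complex"
  assumes hol: "g holomorphic_on UNIV"
    and p: "norm (g p) < s" and z0: "norm (g z0) > s"
  shows "\<exists>z\<in>connected_component_set {z. norm (g z) > s} z0. norm (g z) > M"
proof (rule ccontr)
  assume neg: "\<not> ?thesis"
  define A where "A = {z. norm (g z) > s}"
  define D where "D = connected_component_set A z0"
  have s: "s > 0" using p norm_ge_zero le_less_trans by blast
  have cont: "continuous_on S g" for S
    using hol holomorphic_on_imp_continuous_on continuous_on_subset by blast
  have gM: "norm (g z) \<le> M" if "z \<in> D" for z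
    using neg that by (force simp: D_def A_def)
  have openA: "open A"
    unfolding A_def by (intro open_Collect_less continuous_intros cont)
  then have openD: "open D" unfolding D_def by (rule open_connected_component)
  have z0D: "z0 \<in> D" using z0 by (simp add: D_def A_def)
  have DA: "D \<subseteq> A" unfolding D_def by (rule connected_component_subset)
  have "D \<in> components A" using z0 by (auto simp: D_def A_def components_def)
  then have "frontier D \<subseteq> frontier A" by (rule frontier_of_components_subset)
  also have "\<dots> \<subseteq> - A" using openA by (auto simp: frontier_def interior_open)
  finally have frD: "norm (g z) \<le> s" if "z \<in> frontier D" for z
    using that by (auto simp: A_def)
  have "open {z. norm (g z) < s}"
    by (intro open_Collect_less continuous_intros cont)
  then obtain d where d: "d > 0" "ball p d \<subseteq> {z. norm (g z) < s}"
    using p open_contains_ball by blast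
  have "closed (- ball p d)" by (simp add: closed_def)
  moreover have "D \<subseteq> - ball p d" using d DA by (force simp: A_def)
  ultimately have "closure D \<subseteq> - ball p d" by (rule closure_minimal[rotated])
  then have dp: "norm (z - p) \<ge> d" if "z \<in> closure D" for z
    using that by (force simp: dist_norm norm_minus_commute)
  have Ms: "M > s" using gM[OF z0D] z0 by simp
  have main: "(norm (g z0) / s) ^ N \<le> norm (z0 - p) / d" for N
  proof -
    \<comment> \<open>On the circle of radius \<open>\<rho>\<close> about \<open>p\<close> the bound \<open>M\<close> already gives \<open>norm q \<le> 1 / d\<close>.\<close>
    define \<rho> where "\<rho> = norm (z0 - p) + d * (M / s) ^ N + 1"
    have \<rho>: "\<rho> > norm (z0 - p)" "\<rho> \<ge> d * (M / s) ^ N" "\<rho> > 0"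
      using d s Ms by (auto simp: \<rho>_def add_nonneg_pos)
    define S where "S = D \<inter> ball p \<rho>"
    have clS: "closure S \<subseteq> closure D \<inter> cball p \<rho>"
      unfolding S_def using closure_mono[of "D \<inter> ball p \<rho>" D]
        closure_mono[of "D \<inter> ball p \<rho>" "ball p \<rho>"] closure_ball[of \<rho> p] \<rho> by auto
    define q where "q z = (g z / of_real s) ^ N / (z - p)" for z
    have ne: "z - p \<noteq> 0" if "z \<in> closure S" for z
      using dp[of z] clS that d by auto
    have "norm (q z0) \<le> 1 / d"
    proof (rule maximum_modulus_frontier[of q S])
      show "q holomorphic_on interior S"
      proof -
        have "z - p \<noteq> 0" if "z \<in> interior S" for z
          using ne interior_subset closure_subset that by blast
        then show ?thesis
          unfolding q_def using s hol
          by (intro holomorphic_intros) (auto intro: holomorphic_on_subset)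
      qed
      show "continuous_on (closure S) q"
        unfolding q_def using s ne by (intro continuous_intros cont) auto
      show "bounded S" by (simp add: S_def bounded_Int)
      show "z0 \<in> S" using z0D \<rho> by (simp add: S_def dist_norm norm_minus_commute)
      show "norm (q z) \<le> 1 / d" if z: "z \<in> frontier S" for z
      proof -
        have zc: "z \<in> closure D" using z clS by (auto simp: frontier_def)
        have nq: "norm (q z) = (norm (g z) / s) ^ N / norm (z - p)"
          using s by (simp add: q_def norm_divide norm_power)
        have "z \<in> frontier D \<or> norm (z - p) = \<rho>"
          using z zc clS openD frontier_Int_subset[of D "ball p \<rho>"] \<rho>
          by (auto simp: S_def dist_norm norm_minus_commute)
        then show ?thesis
        proof
          assume "z \<in> frontier D"
          then have "(norm (g z) / s) ^ N \<le> 1"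
            using frD s by (intro power_le_one) auto
          then show ?thesis using nq dp[OF zc] d by (simp add: frac_le)
        next
          assume zr: "norm (z - p) = \<rho>"
          have "closure D \<subseteq> {z. norm (g z) \<le> M}"
            using gM by (intro closure_minimal closed_Collect_le continuous_intros cont) auto
          then have "(norm (g z) / s) ^ N \<le> (M / s) ^ N"
            using zc s by (intro power_mono divide_right_mono) auto
          also have "\<dots> \<le> \<rho> / d" using \<rho> d by (simp add: field_simps)
          finally have "(norm (g z) / s) ^ N / \<rho> \<le> \<rho> / d / \<rho>"
            using \<rho> by (intro divide_right_mono) auto
          then show ?thesis using nq zr \<rho> by simp
        qed
      qed
    qed
    moreover have "norm (z0 - p) > 0" using dp[of z0] z0D closure_subset d by fastforce
    moreover have "norm (q z0) = (norm (g z0) / s) ^ N / norm (z0 - p)"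
      using s by (simp add: q_def norm_divide norm_power)
    ultimately show ?thesis
      using d by (simp add: divide_le_eq)
  qed
  have "norm (g z0) / s > 1" using z0 s by simp
  then obtain N where "(norm (g z0) / s) ^ N > norm (z0 - p) / d"
    using real_arch_pow by blast
  then show False using main[of N] by simp
qed

text \<open>On \<open>[n, n + 1]\<close> the glued path runs through \<open>p n\<close>; the endpoint condition takes care of the
  jumps of \<open>\<lfloor>t\<rfloor>\<close>.\<close>

lemma continuous_on_glue_unit_paths:
  fixes p :: "nat \<Rightarrow> real \<Rightarrow> 'a::topological_space"
  assumes p: "\<And>n. path (p n)" and ends: "\<And>n. p n 1 = p (Suc n) 0"
  shows "continuous_on {0..} (\<lambda>t. p (nat \<lfloor>t\<rfloor>) (t - of_int \<lfloor>t\<rfloor>))" (is "continuous_on _ ?\<gamma>")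
proof -
  have piece: "continuous_on {real n..real (Suc n)} ?\<gamma>" for n
  proof -
    have "continuous_on {0..1} (p n)" using p[of n] by (simp add: path_def)
    then have "continuous_on {real n..real (Suc n)} (\<lambda>t. p n (t - real n))"
      by (rule continuous_on_compose2) (auto intro!: continuous_intros)
    moreover have "p n (t - real n) = ?\<gamma> t" if t: "t \<in> {real n..real (Suc n)}" for t
    proof (cases "t = real (Suc n)")
      case True
      have "\<lfloor>t\<rfloor> = int (Suc n)" using True by (metis floor_of_nat)
      then have "?\<gamma> t = p (Suc n) 0" using True by (simp only: nat_int) simp
      then show ?thesis using True ends by simp
    next
      case False
      then have "\<lfloor>t\<rfloor> = int n" using t by (intro floor_unique) auto
      then show ?thesis by simp
    qed
    ultimately show ?thesis by (rule continuous_on_eq)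
  qed
  have init: "continuous_on {0..real n} ?\<gamma>" for n
  proof (induction n)
    case (Suc n)
    have "{0..real (Suc n)} = {0..real n} \<union> {real n..real (Suc n)}" by auto
    then show ?case
      using continuous_on_closed_Un[OF _ _ Suc piece[of n]] by simp
  qed simp
  show ?thesis
    unfolding continuous_on_eq_continuous_within
  proof
    fix t :: real assume t: "t \<in> {0..}"
    obtain n where n: "t < real n" using reals_Archimedean2 by blast
    have "continuous (at t within {0..real n}) ?\<gamma>"
      using init[of n] t n by (auto simp: continuous_on_eq_continuous_within)
    moreover have "at t within {0..} = at t within {0..real n}"
      using n t by (intro at_within_nhd[of _ "{..<real n}"]) auto
    ultimately show "continuous (at t within {0..}) ?\<gamma>"
      by (simp add: continuous_within)
  qed
qed

text \<open>Iversen's theorem for the value \<open>\<infinity>\<close>. Inside a component of \<open>{norm g > s + n}\<close> the function is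
  unbounded, so it is possible to walk inside this component to a point where \<open>norm g > s + n + 1\<close>.
  The concatenated path tends to infinity because \<open>g\<close> is bounded on bounded sets.\<close>

lemma iversen_infinity:
  fixes g :: "complex \<Rightarrow> complex"
  assumes hol: "g holomorphic_on UNIV" and nonconst: "\<not> g constant_on UNIV"
  obtains \<gamma> :: "real \<Rightarrow> complex" where "continuous_on {0..} \<gamma>"
    "filterlim \<gamma> at_infinity at_top" "filterlim (\<lambda>t. g (\<gamma> t)) at_infinity at_top"
proof -
  define s where "s = norm (g 0) + 1"
  define A where "A n = {z. norm (g z) > s + real n}" for n
  have cont: "continuous_on S g" for S
    using hol holomorphic_on_imp_continuous_on continuous_on_subset by blast
  have openA: "open (A n)" for n
    unfolding A_def by (intro open_Collect_less continuous_intros cont)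
  have "\<exists>z. z \<in> A 0"
    using entire_exceeds_norm[OF hol nonconst, of s] by (simp add: A_def)
  moreover have "\<exists>z'. z' \<in> A (Suc n) \<and> path_component (A n) z z'" if "z \<in> A n" for z n
  proof -
    have "norm (g 0) < s + real n" "s + real n < norm (g z)"
      using that by (auto simp: s_def A_def)
    then obtain z' where "z' \<in> connected_component_set (A n) z" "norm (g z') > s + real (Suc n)"
      using unbounded_on_superlevel_component[OF hol] unfolding A_def by metis
    then show ?thesis
      using open_path_connected_component[OF openA] by (auto simp: A_def)
  qed
  ultimately obtain z where z: "\<And>n. path_component (A n) (z n) (z (Suc n))"
    using dependent_nat_choice[of "\<lambda>n z. z \<in> A n" "\<lambda>n z z'. path_component (A n) z z'"] by metis
  then obtain p where p: "\<And>n. path (p n)" "\<And>n. path_image (p n) \<subseteq> A n"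
    "\<And>n. pathstart (p n) = z n" "\<And>n. pathfinish (p n) = z (Suc n)"
    unfolding path_component_def by metis
  define \<gamma> where "\<gamma> t = p (nat \<lfloor>t\<rfloor>) (t - of_int \<lfloor>t\<rfloor>)" for t :: real
  have cg: "continuous_on {0..} \<gamma>"
    unfolding \<gamma>_def
    by (intro continuous_on_glue_unit_paths p) (metis p(3,4) pathfinish_def pathstart_def)
  have in_A: "\<gamma> t \<in> A (nat \<lfloor>t\<rfloor>)" for t
  proof -
    have "t - of_int \<lfloor>t\<rfloor> \<in> {0..1}" by (simp) linarith
    then show ?thesis using p(2) unfolding \<gamma>_def path_image_def by blast
  qed
  have lower: "norm (g (\<gamma> t)) \<ge> t - 1" for t
  proof -
    have "s + real (nat \<lfloor>t\<rfloor>) < norm (g (\<gamma> t))" using in_A[of t] by (simp add: A_def)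
    moreover have "s \<ge> 0" by (simp add: s_def)
    ultimately show ?thesis by linarith
  qed
  have "filterlim (\<lambda>t::real. t - 1) at_top at_top" by real_asymp
  then have ninf: "filterlim (\<lambda>t. norm (g (\<gamma> t))) at_top at_top"
    by (rule filterlim_at_top_mono) (simp add: lower)
  then have g_inf: "filterlim (\<lambda>t. g (\<gamma> t)) at_infinity at_top"
    by (rule filterlim_norm_at_top_imp_at_infinity)
  have "filterlim \<gamma> at_infinity at_top"
    unfolding filterlim_at_infinity[OF order_refl]
  proof (intro allI impI)
    fix r :: real
    have "bounded (g ` cball 0 r)"
      by (intro compact_imp_bounded compact_continuous_image cont) simp
    then obtain C where C: "\<And>x. norm x \<le> r \<Longrightarrow> norm (g x) \<le> C"
      unfolding bounded_iff by (metis image_eqI mem_cball_0)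
    have "\<forall>\<^sub>F t in at_top. norm (g (\<gamma> t)) > C"
      using ninf by (simp add: filterlim_at_top_dense)
    then show "\<forall>\<^sub>F t in at_top. r \<le> norm (\<gamma> t)"
      by eventually_elim (use C in \<open>meson linorder_not_le less_imp_le\<close>)
  qed
  then show ?thesis using that cg g_inf by blast
qed

lemma omitted_zero_is_asymptotic_value:
  fixes F :: "complex \<Rightarrow> complex"
  assumes hol: "F holomorphic_on UNIV" and nonconst: "\<not> F constant_on UNIV"
    and nz: "\<And>z. F z \<noteq> 0"
  shows "0 \<in> asymptotic_values F"
proof -
  have "(\<lambda>z. inverse (F z)) holomorphic_on UNIV"
    using hol nz by (intro holomorphic_intros) auto
  moreover have "\<not> (\<lambda>z. inverse (F z)) constant_on UNIV"
  proof
    assume "(\<lambda>z. inverse (F z)) constant_on UNIV"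
    then obtain d where "\<And>z. inverse (F z) = d" by (auto simp: constant_on_def)
    then have "F z = inverse d" for z by (metis inverse_inverse_eq)
    then show False using nonconst by (auto simp: constant_on_def)
  qed
  ultimately obtain \<gamma> :: "real \<Rightarrow> complex" where \<gamma>: "continuous_on {0..} \<gamma>"
    "filterlim \<gamma> at_infinity at_top" "filterlim (\<lambda>t. inverse (F (\<gamma> t))) at_infinity at_top"
    by (rule iversen_infinity)
  from filterlim_compose[OF tendsto_inverse_0 \<gamma>(3)]
  have "((\<lambda>t. F (\<gamma> t)) \<longlongrightarrow> 0) at_top" by simp
  then show ?thesis using \<gamma> by (auto simp: asymptotic_values_def)
qed

lemma unique_lift_locally_univalent:
  fixes S :: "real set"
  assumes h: "locally_univalent h" and S: "connected S"
    and p: "continuous_on S p" and q: "continuous_on S q"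
    and eq: "\<And>t. t \<in> S \<Longrightarrow> h (p t) = h (q t)"
    and a: "a \<in> S" "p a = q a" and b: "b \<in> S"
  shows "p b = q b"
proof -
  define E where "E = {t\<in>S. p t = q t}"
  have "closedin (top_of_set S) {t\<in>S. p t - q t = 0}"
    by (intro continuous_closedin_preimage_constant continuous_intros p q)
  then have cl: "closedin (top_of_set S) E" by (simp add: E_def)
  have op: "openin (top_of_set S) E"
  proof (subst openin_subopen, intro ballI)
    fix t assume t: "t \<in> E"
    obtain V where V: "open V" "p t \<in> V" "inj_on h V"
      using h unfolding locally_univalent_def by blast
    have "openin (top_of_set S) ((S \<inter> p -` V) \<inter> (S \<inter> q -` V))"
      using V p q by (intro openin_Int continuous_openin_preimage_gen)
    moreover have "(S \<inter> p -` V) \<inter> (S \<inter> q -` V) \<subseteq> E"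
      using V eq by (auto simp: E_def dest: inj_onD)
    ultimately show "\<exists>T. openin (top_of_set S) T \<and> t \<in> T \<and> T \<subseteq> E"
      using t V by (intro exI[of _ "(S \<inter> p -` V) \<inter> (S \<inter> q -` V)"]) (auto simp: E_def)
  qed
  have "E = {} \<or> E = S"
    using S cl op by (simp add: connected_clopen)
  then show ?thesis using a b by (auto simp: E_def)
qed

text \<open>An asymptotic value of the limit cannot lie in a disc over which all \<open>h n\<close> have inverse branches.
  If \<open>\<gamma>\<close> were an asymptotic path with limit at the centre, take the branch of the inverse of \<open>h n\<close>
  that sends \<open>h n (\<gamma> t0)\<close> to \<open>\<gamma> t0\<close>. It omits any two points \<open>p\<close>, \<open>q\<close> which \<open>h n\<close> maps outside the
  disc, and since \<open>h n\<close> converges, the same two points serve for all large \<open>n\<close>. Schottky's theorem then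
  bounds the branches on a smaller disc by a constant \<open>M\<close> independent of \<open>n\<close>. By uniqueness of lifts
  the branch follows \<open>\<gamma>\<close> as far as \<open>h n\<close> is close to \<open>f\<close>, so \<open>\<gamma>\<close> never leaves the disc of radius \<open>M\<close>.\<close>

lemma not_asymptotic_value_of_limit:
  fixes h :: "nat \<Rightarrow> complex \<Rightarrow> complex"
  assumes hol: "\<And>n. h n holomorphic_on UNIV" "f holomorphic_on UNIV"
    and univ: "\<And>n. locally_univalent (h n)"
    and ul: "\<And>X. uniform_limit (cball 0 X) h f sequentially"
    and nonconst: "\<not> f constant_on UNIV"
    and r: "r > 0"
    and branch: "\<And>n z. h n z \<in> ball w r \<Longrightarrow>
       \<exists>\<phi>. \<phi> holomorphic_on ball w r \<and> (\<forall>u\<in>ball w r. h n (\<phi> u) = u) \<and> \<phi> (h n z) = z"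
  shows "w \<notin> asymptotic_values f"
proof
  assume "w \<in> asymptotic_values f"
  then obtain \<gamma> :: "real \<Rightarrow> complex" where \<gamma>: "continuous_on {0..} \<gamma>"
    "filterlim \<gamma> at_infinity at_top" "((\<lambda>t. f (\<gamma> t)) \<longlongrightarrow> w) at_top"
    by (auto simp: asymptotic_values_def)
  have cont: "continuous_on S f" "continuous_on S (h n)" for S n
    using hol holomorphic_on_imp_continuous_on continuous_on_subset by blast+
  obtain p q where pq: "p \<noteq> q" "norm (f p - w) > r" "norm (f q - w) > r"
  proof -
    let ?O = "{z. norm (f z - w) > r}"
    have op: "open ?O" by (intro open_Collect_less continuous_intros cont)
    obtain p where p: "norm (f p) > norm w + r"
      using entire_exceeds_norm[OF hol(2) nonconst] by blast
    then have pO: "p \<in> ?O" using norm_triangle_ineq2[of "f p" w] by simp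
    have "\<not> ?O \<subseteq> {p}"
      using op pO not_open_singleton[of p] by (metis subset_singletonD empty_iff)
    then obtain q where "q \<in> ?O" "q \<noteq> p" by blast
    then show ?thesis using that pO by blast
  qed
  have "\<forall>\<^sub>F t in at_top. dist (f (\<gamma> t)) w < r / 16"
    using \<gamma>(3) r by (intro tendstoD) auto
  then obtain t' where t': "\<And>t. t \<ge> t' \<Longrightarrow> dist (f (\<gamma> t)) w < r / 16"
    by (auto simp: eventually_at_top_linorder)
  define t0 where "t0 = max 0 t'"
  have t0: "t0 \<ge> 0" "\<And>t. t \<ge> t0 \<Longrightarrow> dist (f (\<gamma> t)) w < r / 16"
    using t' by (auto simp: t0_def)
  \<comment> \<open>Schottky's bound at radius \<open>1 / 2\<close>, transported by the affine map sending \<open>0\<close>, \<open>1\<close> to \<open>p\<close>, \<open>q\<close>.\<close>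
  define M where "M = norm p + norm (q - p) *
    exp (pi * exp (pi * (2 + 2 * norm ((\<gamma> t0 - p) / (q - p)) + 12 * (1 / 2) / (1 - 1 / 2))))"
  have "\<forall>\<^sub>F t in at_top. norm (\<gamma> t) \<ge> \<bar>M\<bar> + 1"
    using \<gamma>(2) by (auto simp: filterlim_at_infinity[OF order_refl])
  then have "\<forall>\<^sub>F t in at_top. norm (\<gamma> t) \<ge> \<bar>M\<bar> + 1 \<and> t \<ge> t0"
    using eventually_ge_at_top by (rule eventually_conj)
  then obtain t1 where t1: "norm (\<gamma> t1) > M" "t1 \<ge> t0"
    by (force simp: eventually_at_top_linorder)
  have c\<gamma>: "continuous_on {t0..t1} \<gamma>"
    using \<gamma>(1) by (rule continuous_on_subset) (use t0 in auto)
  have "compact (insert p (insert q (\<gamma> ` {t0..t1})))"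
    by (intro compact_insert compact_continuous_image c\<gamma>) simp
  then have "bounded (insert p (insert q (\<gamma> ` {t0..t1})))" by (rule compact_imp_bounded)
  then obtain X where X: "norm p \<le> X" "norm q \<le> X" "\<And>t. t \<in> {t0..t1} \<Longrightarrow> norm (\<gamma> t) \<le> X"
    by (auto simp: bounded_iff)
  \<comment> \<open>Close enough to keep \<open>h n p\<close> and \<open>h n q\<close> outside the disc and \<open>h n \<circ> \<gamma>\<close> near its centre.\<close>
  define \<eta> where "\<eta> = min (r / 16) (min (norm (f p - w) - r) (norm (f q - w) - r))"
  have "\<eta> > 0" using r pq by (simp add: \<eta>_def)
  then have "\<forall>\<^sub>F n in sequentially. \<forall>z\<in>cball 0 X. dist (h n z) (f z) < \<eta>"
    using ul by (rule uniform_limitD[rotated])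
  then obtain n where n: "\<And>z. norm z \<le> X \<Longrightarrow> dist (h n z) (f z) < \<eta>"
    unfolding eventually_sequentially mem_cball_0[symmetric] by blast
  have omit: "h n p \<notin> ball w r" "h n q \<notin> ball w r"
    using n[OF X(1)] n[OF X(2)] norm_triangle_ineq[of "f p - h n p" "h n p - w"]
      norm_triangle_ineq[of "f q - h n q" "h n q - w"]
    by (auto simp: \<eta>_def dist_norm norm_minus_commute)
  have near: "dist (h n (\<gamma> t)) w < r / 8" if "t \<in> {t0..t1}" for t
    using n[OF X(3)[OF that]] t0(2)[of t] that dist_triangle[of "h n (\<gamma> t)" w "f (\<gamma> t)"]
    by (auto simp: \<eta>_def)
  define c where "c = h n (\<gamma> t0)"
  have c: "dist c w < r / 8" unfolding c_def by (rule near) (use t1 in auto)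
  then have "h n (\<gamma> t0) \<in> ball w r" using r by (simp add: c_def dist_commute)
  then obtain \<phi> where \<phi>: "\<phi> holomorphic_on ball w r" "\<And>u. u \<in> ball w r \<Longrightarrow> h n (\<phi> u) = u"
    "\<phi> c = \<gamma> t0"
    using branch unfolding c_def by blast
  have bound: "norm (\<phi> u) \<le> M" if u: "dist u w < r / 8" for u
  proof -
    define \<psi> where "\<psi> x = (\<phi> (c + of_real (r / 2) * x) - p) / (q - p)" for x
    have in_ball: "c + of_real (r / 2) * x \<in> ball w r" if "x \<in> cball 0 1" for x
    proof -
      have "norm (of_real (r / 2) * x) \<le> r / 2"
        using that r by (simp add: norm_mult)
      then show ?thesis
        using c r norm_triangle_ineq[of "c - w" "of_real (r / 2) * x"]
        by (simp add: dist_norm norm_minus_commute algebra_simps)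
    qed
    define x where "x = (u - c) / of_real (r / 2)"
    have ux: "u = c + of_real (r / 2) * x" using r by (simp only: x_def times_divide_eq_right) simp
    have "norm (\<psi> x) \<le> exp (pi * exp (pi * (2 + 2 * norm ((\<gamma> t0 - p) / (q - p))
                         + 12 * (1 / 2) / (1 - 1 / 2))))"
    proof (rule Schottky[of \<psi>])
      have "\<phi> \<circ> (\<lambda>x. c + of_real (r / 2) * x) holomorphic_on cball 0 1"
        using in_ball by (intro holomorphic_on_compose_gen[OF _ \<phi>(1)] holomorphic_intros) auto
      then show "\<psi> holomorphic_on cball 0 1"
        unfolding \<psi>_def o_def using pq by (intro holomorphic_intros) auto
      show "norm (\<psi> 0) \<le> norm ((\<gamma> t0 - p) / (q - p))"
        by (simp add: \<psi>_def \<phi>(3))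
      show "\<not> (\<psi> y = 0 \<or> \<psi> y = 1)" if "y \<in> cball 0 1" for y
      proof -
        have "\<phi> (c + of_real (r / 2) * y) \<notin> {p, q}"
          using \<phi>(2)[OF in_ball[OF that]] in_ball[OF that] omit by auto
        then show ?thesis using pq by (auto simp: \<psi>_def divide_eq_1_iff)
      qed
      have "norm (u - c) \<le> r / 4"
        using u c dist_triangle2[of u c w] by (simp add: dist_norm)
      moreover have "norm x = norm (u - c) / (r / 2)"
        unfolding x_def norm_divide norm_of_real using r by simp
      ultimately show "norm x \<le> 1 / 2" using r by (simp add: divide_le_eq)
    qed auto
    moreover have "\<psi> x = (\<phi> u - p) / (q - p)"
      by (simp only: \<psi>_def ux[symmetric])
    then have "\<phi> u = p + (q - p) * \<psi> x"
      using pq by simp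
    then have "norm (\<phi> u) \<le> norm p + norm (q - p) * norm (\<psi> x)"
      by (metis norm_mult norm_triangle_ineq)
    ultimately show ?thesis
      unfolding M_def by (meson add_left_mono mult_left_mono norm_ge_zero order_trans)
  qed
  have "\<phi> (h n (\<gamma> t1)) = \<gamma> t1"
  proof (rule unique_lift_locally_univalent[OF univ[of n], of "{t0..t1}" "\<lambda>t. \<phi> (h n (\<gamma> t))" \<gamma> t0 t1])
    have "continuous_on {t0..t1} (\<lambda>t. h n (\<gamma> t))"
      by (rule continuous_on_compose2[OF cont(2)[of UNIV] c\<gamma>]) auto
    moreover have in_B: "h n (\<gamma> t) \<in> ball w r" if "t \<in> {t0..t1}" for t
      using near[OF that] r by (simp add: dist_commute)
    ultimately show "continuous_on {t0..t1} (\<lambda>t. \<phi> (h n (\<gamma> t)))"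
      by (intro continuous_on_compose2[OF holomorphic_on_imp_continuous_on[OF \<phi>(1)]]) auto
    show "h n (\<phi> (h n (\<gamma> t))) = h n (\<gamma> t)" if "t \<in> {t0..t1}" for t
      using \<phi>(2) in_B[OF that] by blast
    show "\<phi> (h n (\<gamma> t0)) = \<gamma> t0" using \<phi>(3) by (simp add: c_def)
  qed (use t1 c\<gamma> in auto)
  then show False using bound[OF near[of t1]] t1 by simp
qed

section \<open>The infinitely iterated exponential\<close>

lemma exists_dense_sequence:
  fixes U :: "complex set"
  assumes "closed U" "0 \<in> U" "\<exists>u\<in>U. u \<noteq> 0"
  obtains w :: "nat \<Rightarrow> complex" where "w 0 = 0" "\<And>n. w (Suc n) \<noteq> 0" "\<And>n. w n \<in> U"
    "closure (range w) = U"
proof -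
  obtain T where T: "countable T" "T \<subseteq> U - {0}" "U - {0} \<subseteq> closure T"
    using separable[of "U - {0}"] by blast
  have "T \<noteq> {}" using T(3) assms by auto
  define w where "w n = (case n of 0 \<Rightarrow> 0 | Suc k \<Rightarrow> from_nat_into T k)" for n
  have w_simps: "w 0 = 0" "w (Suc n) = from_nat_into T n" for n
    by (simp_all add: w_def)
  have Tw: "from_nat_into T k \<in> T" for k
    using \<open>T \<noteq> {}\<close> by (rule from_nat_into)
  have wU: "w n \<in> U" for n
    using Tw T assms by (auto simp: w_def split: nat.split)
  have "T \<subseteq> range w"
  proof
    fix x assume "x \<in> T"
    then obtain k where "x = from_nat_into T k" using from_nat_into_surj T by metis
    then have "x = w (Suc k)" by (simp add: w_simps)
    then show "x \<in> range w" by blast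
  qed
  then have "U - {0} \<subseteq> closure (range w)" using T(3) closure_mono by blast
  moreover have "w 0 \<in> closure (range w)" by (intro subsetD[OF closure_subset] rangeI)
  ultimately have "U \<subseteq> closure (range w)" using w_simps(1) by auto
  moreover have "closure (range w) \<subseteq> U" using wU assms by (intro closure_minimal) auto
  ultimately have "closure (range w) = U" by simp
  moreover have "w (Suc n) \<noteq> 0" for n using Tw[of n] T(2) by (auto simp: w_simps)
  ultimately show ?thesis by (intro that[of w] w_simps(1) wU)
qed

theorem theorem1:
  fixes U K :: "complex set" and \<epsilon> :: real
  assumes "closed U" and "0 \<in> U" and "\<exists>u\<in>U. u \<noteq> 0"
    and "compact K" and "\<epsilon> > 0"
  shows "\<exists>f. f holomorphic_on UNIV \<and> locally_univalent f \<and> f \<in> iterated_exp_class \<and>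
             singular_values f = U \<and>
             sup_norm_on K (\<lambda>z. f z - exp z) \<le> ennreal \<epsilon>"
proof -
  obtain w where w: "w 0 = 0" "\<And>n. w (Suc n) \<noteq> 0" "\<And>n. w n \<in> U" "closure (range w) = U"
    using exists_dense_sequence[OF assms(1-3)] by blast
  obtain c where c: "\<And>n. c (Suc n) \<noteq> 0" "\<And>n. tower c 0 (Suc n) 0 = w (Suc n)"
    using exists_multipliers[of w] w(2) by blast
  have tower0: "tower c 0 n 0 = w n" for n
    using c(2) w(1) by (cases n) auto
  obtain R where R: "\<And>z. z \<in> K \<Longrightarrow> norm z \<le> R"
    using compact_imp_bounded[OF assms(4)] by (auto simp: bounded_iff)
  obtain a \<alpha> :: "nat \<Rightarrow> complex" where a0: "a 0 = 1" "\<alpha> 0 = 1"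
    and nz: "\<And>n. a n \<noteq> 0" "\<And>n. \<alpha> n \<noteq> 0"
    and rec: "\<And>n. c (Suc n) * exp (a (Suc n)) = a n" "\<And>n. \<alpha> (Suc n) = \<alpha> n / a n"
    and close: "\<And>n m z. 1 \<le> n \<Longrightarrow> m \<le> n \<Longrightarrow> norm z \<le> R + real n \<Longrightarrow>
       norm (tower c m (n - m) (a n * exp (\<alpha> n * z / a n)) - tower c m (n - m) (a n + \<alpha> n * z))
         \<le> \<epsilon> / 2 ^ n"
    by (rule exists_rescalings[of c \<epsilon> R, OF c(1) assms(5)]) (rule that)
  define H where "H m n z = tower c m (n - m) (a n + \<alpha> n * z)" for m n z
  have tower_hol: "(\<lambda>z. tower c m k (g z)) holomorphic_on UNIV" if "g holomorphic_on UNIV" for m k g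
    using holomorphic_on_compose[OF that tower_holomorphic] by (simp add: o_def)
  have H_hol: "H m n holomorphic_on UNIV" for m n
    unfolding H_def by (intro tower_hol holomorphic_intros)
  have H_Suc: "H m (Suc n) z = tower c m (n - m) (a n * exp (\<alpha> n * z / a n))" if "m \<le> n" for m n z
  proof -
    have "c (Suc n) * exp (a (Suc n) + \<alpha> (Suc n) * z) = a n * exp (\<alpha> n * z / a n)"
      unfolding exp_add rec(2) mult.assoc[symmetric] rec(1) by simp
    then show ?thesis using that by (simp add: H_def Suc_diff_le scaled_exp_def)
  qed
  define limit_of :: "nat \<Rightarrow> (complex \<Rightarrow> complex) \<Rightarrow> bool" where
    "limit_of m G \<longleftrightarrow> G holomorphic_on UNIV \<and> (\<forall>r. uniform_limit (cball 0 r) (H m) G sequentially) \<and>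
       (\<forall>n\<ge>max 1 m. \<forall>z. norm z \<le> R + real n \<longrightarrow> norm (G z - H m n z) \<le> 2 * \<epsilon> / 2 ^ n)" for m G
  have "\<exists>G. limit_of m G" for m
  proof -
    have step: "norm (H m (Suc n) z - H m n z) \<le> \<epsilon> / 2 ^ n"
      if "max 1 m \<le> n" "norm z \<le> R + real n" for n z
    proof -
      have n: "1 \<le> n" "m \<le> n" using that by auto
      show ?thesis unfolding H_Suc[OF n(2)] using close[OF n that(2)] unfolding H_def .
    qed
    show ?thesis
    proof (rule geometric_uniform_limit[of "H m" "max 1 m" R \<epsilon>, OF H_hol step assms(5)])
      fix G
      assume "G holomorphic_on UNIV" "\<And>r. uniform_limit (cball 0 r) (H m) G sequentially"
        "\<And>n z. max 1 m \<le> n \<Longrightarrow> norm z \<le> R + real n \<Longrightarrow> norm (G z - H m n z) \<le> 2 * \<epsilon> / 2 ^ n"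
      then show ?thesis unfolding limit_of_def by blast
    qed
  qed
  then obtain F where "\<And>m. limit_of m (F m)" by metis
  then have F: "\<And>m. F m holomorphic_on UNIV"
    "\<And>m r. uniform_limit (cball 0 r) (H m) (F m) sequentially"
    "\<And>m n z. max 1 m \<le> n \<Longrightarrow> norm z \<le> R + real n \<Longrightarrow> norm (F m z - H m n z) \<le> 2 * \<epsilon> / 2 ^ n"
    unfolding limit_of_def by simp_all
  have F_lim: "(\<lambda>n. H m n z) \<longlonglongrightarrow> F m z" for m z
    using tendsto_uniform_limitI[OF F(2)[of m "norm z"], of z] by simp
  have F_rec: "F m z = scaled_exp (c (Suc m)) (F (Suc m) z)" for m z
  proof (rule LIMSEQ_unique)
    have "(\<lambda>n. scaled_exp (c (Suc m)) (H (Suc m) n z)) \<longlonglongrightarrow> scaled_exp (c (Suc m)) (F (Suc m) z)"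
      unfolding scaled_exp_def by (intro tendsto_intros F_lim)
    moreover have "\<forall>\<^sub>F n in sequentially. scaled_exp (c (Suc m)) (H (Suc m) n z) = H m n z"
      using eventually_ge_at_top[of "Suc m"]
    proof eventually_elim
      case (elim n)
      then have "n - m = Suc (n - Suc m)" by simp
      then show ?case by (simp only: H_def tower_Suc_outer)
    qed
    ultimately show "(\<lambda>n. H m n z) \<longlonglongrightarrow> scaled_exp (c (Suc m)) (F (Suc m) z)"
      by (rule Lim_transform_eventually)
  qed (rule F_lim)
  define f where "f = F 0"
  have f_tower: "f z = tower c 0 n (F n z)" for n z
    by (induction n) (auto simp: f_def F_rec[symmetric])
  have dH: "deriv (H 0 n) z \<noteq> 0" for n z
  proof -
    obtain d where d: "d \<noteq> 0" "(tower c 0 n has_field_derivative d) (at (a n + \<alpha> n * z))"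
      using tower_has_nonzero_derivative[of c, OF c(1)] by blast
    have "((\<lambda>z. a n + \<alpha> n * z) has_field_derivative \<alpha> n) (at z)"
      by (auto intro!: derivative_eq_intros)
    from DERIV_chain2[OF d(2) this] have "(H 0 n has_field_derivative d * \<alpha> n) (at z)"
      by (simp add: H_def[abs_def])
    then show ?thesis using d nz by (simp add: DERIV_imp_deriv)
  qed
  \<comment> \<open>The affine map and the exponential replacing it agree to first order at \<open>0\<close>.\<close>
  have dH0: "deriv (H 0 n) 0 = 1" for n
  proof (induction n)
    case 0
    have "H 0 0 = (\<lambda>z. 1 + z)" by (auto simp: H_def a0)
    then show ?case by simp
  next
    case (Suc n)
    obtain d where d: "(tower c 0 n has_field_derivative d) (at (a n))"
      using tower_has_nonzero_derivative[of c, OF c(1)] by blast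
    have affine: "((\<lambda>z. a n + \<alpha> n * z) has_field_derivative \<alpha> n) (at 0)"
      by (auto intro!: derivative_eq_intros)
    have exp_affine: "((\<lambda>z. a n * exp (\<alpha> n * z / a n)) has_field_derivative \<alpha> n) (at 0)"
      using nz by (auto intro!: derivative_eq_intros)
    have "(H 0 n has_field_derivative d * \<alpha> n) (at 0)"
      using DERIV_chain2[OF _ affine, of "tower c 0 n" d] d by (simp add: H_def[abs_def])
    moreover have "H 0 (Suc n) = (\<lambda>z. tower c 0 n (a n * exp (\<alpha> n * z / a n)))"
      using H_Suc[of 0 n] by auto
    then have "(H 0 (Suc n) has_field_derivative d * \<alpha> n) (at 0)"
      using DERIV_chain2[OF _ exp_affine, of "tower c 0 n" d] d by simp
    ultimately show ?case using Suc DERIV_imp_deriv by metis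
  qed
  have f_hol: "f holomorphic_on UNIV" unfolding f_def by (rule F(1))
  have f_ul: "uniform_limit (cball 0 r) (H 0) f sequentially" for r
    unfolding f_def by (rule F(2))
  have "(\<lambda>n. deriv (H 0 n) 0) \<longlonglongrightarrow> deriv f 0"
    using tendsto_uniform_limitI[OF uniform_limit_deriv[OF H_hol f_hol f_ul, of 0], of 0] by simp
  then have df0: "deriv f 0 = 1"
    by (simp add: dH0 LIMSEQ_const_iff)
  have df: "deriv f z \<noteq> 0" for z
    by (rule deriv_limit_nonzero[OF H_hol f_hol f_ul dH, of 0]) (simp add: df0)
  have f_nonconst: "\<not> f constant_on UNIV"
  proof
    assume "f constant_on UNIV"
    then obtain v where "f = (\<lambda>_. v)" by (auto simp: constant_on_def)
    then show False using df0 by simp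
  qed
  have asymptotic_in_U: "v \<in> U" if v: "v \<in> asymptotic_values f" for v
  proof (rule ccontr)
    assume "v \<notin> U"
    then obtain r where r: "r > 0" "ball v r \<subseteq> - U"
      using assms(1) open_contains_ball[of "- U"] by (auto simp: open_Compl)
    have "v \<notin> asymptotic_values f"
    proof (rule not_asymptotic_value_of_limit[OF H_hol f_hol _ f_ul f_nonconst r(1)])
      show "locally_univalent (H 0 n)" for n
        using locally_univalent_iff_deriv_nonzero[OF H_hol] dH by blast
    next
      fix n z assume z: "H 0 n z \<in> ball v r"
      have "tower c 0 j 0 \<notin> ball v r" for j
        using r(2) w(3)[of j] tower0[of j] by auto
      then obtain \<psi> where \<psi>: "\<psi> holomorphic_on ball v r" "\<And>u. u \<in> ball v r \<Longrightarrow> tower c 0 n (\<psi> u) = u"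
        "\<psi> (H 0 n z) = a n + \<alpha> n * z"
        using tower_inverse_branch[of c "ball v r" n 0, OF c(1) convex_ball, of "a n + \<alpha> n * z"] z
        by (auto simp: H_def)
      show "\<exists>\<phi>. \<phi> holomorphic_on ball v r \<and> (\<forall>u\<in>ball v r. H 0 n (\<phi> u) = u) \<and> \<phi> (H 0 n z) = z"
      proof (intro exI conjI ballI)
        show "(\<lambda>u. (\<psi> u - a n) / \<alpha> n) holomorphic_on ball v r"
          using \<psi>(1) nz by (intro holomorphic_intros) auto
        show "H 0 n ((\<psi> u - a n) / \<alpha> n) = u" if "u \<in> ball v r" for u
          using \<psi>(2)[OF that] nz by (simp add: H_def)
        show "(\<psi> (H 0 n z) - a n) / \<alpha> n = z"
          using \<psi>(3) nz by simp
      qed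
    qed
    then show False using v by blast
  qed
  have w_asymptotic: "w n \<in> asymptotic_values f" for n
  proof -
    have "\<not> F n constant_on UNIV"
    proof
      assume "F n constant_on UNIV"
      then obtain v where "\<And>z. F n z = v" by (auto simp: constant_on_def)
      then have "f z = tower c 0 n v" for z using f_tower[of z n] by simp
      then show False using f_nonconst by (auto simp: constant_on_def)
    qed
    moreover have "F n z \<noteq> 0" for z
      using F_rec[of n z] c(1) by (simp add: scaled_exp_def)
    ultimately have "0 \<in> asymptotic_values (F n)"
      using F(1) by (intro omitted_zero_is_asymptotic_value)
    then obtain \<gamma> :: "real \<Rightarrow> complex" where \<gamma>: "continuous_on {0..} \<gamma>" "filterlim \<gamma> at_infinity at_top"
      "((\<lambda>t. F n (\<gamma> t)) \<longlongrightarrow> 0) at_top"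
      by (auto simp: asymptotic_values_def)
    have "isCont (tower c 0 n) 0"
      using tower_has_nonzero_derivative[of c, OF c(1)] DERIV_isCont by blast
    from isCont_tendsto_compose[OF this \<gamma>(3)]
    have "((\<lambda>t. f (\<gamma> t)) \<longlongrightarrow> w n) at_top"
      by (simp add: f_tower[of _ n] tower0)
    then show ?thesis using \<gamma> by (auto simp: asymptotic_values_def)
  qed
  have "singular_values f = U"
  proof -
    have "critical_values f = {}" using df by (simp add: critical_values_def)
    then have "singular_values f = closure (asymptotic_values f)"
      by (simp add: singular_values_def)
    moreover have "closure (asymptotic_values f) \<subseteq> U"
      using asymptotic_in_U assms(1) by (intro closure_minimal) auto
    moreover have "U \<subseteq> closure (asymptotic_values f)"
      unfolding w(4)[symmetric] using w_asymptotic by (intro closure_mono) auto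
    ultimately show ?thesis by blast
  qed
  moreover have "f \<in> iterated_exp_class"
    unfolding iterated_exp_class_def using F(1) F_rec f_def by blast
  moreover have "locally_univalent f"
    using locally_univalent_iff_deriv_nonzero[OF f_hol] df by blast
  moreover have "sup_norm_on K (\<lambda>z. f z - exp z) \<le> ennreal \<epsilon>"
    unfolding sup_norm_on_def
  proof (intro SUP_least ennreal_leI)
    fix z assume "z \<in> K"
    then have "norm (F 0 z - H 0 1 z) \<le> 2 * \<epsilon> / 2 ^ 1"
      using R by (intro F(3)) (auto intro: add_increasing2)
    moreover have "H 0 1 z = exp z"
      using H_Suc[of 0 0 z] by (simp add: a0)
    ultimately show "norm (f z - exp z) \<le> \<epsilon>" by (simp add: f_def)
  qed
  ultimately show ?thesis using f_hol by blast
qed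

end
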